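(* Let $m,l\in\mathbb{N}$ and let $\psi$ be a norm on $\mathbb{R}^l$ monotone with respect to the natural partial order. For every $j=1,\dots,m$ let $n_j\in\mathbb{N}$, $\omega_j$ a modulus of continuity, $e_j\in\mathbb{R}^{n_j}_+$, $U_j=U_{e_j}$, $M_j$ a metric space with metric $\rho_j$, $\mu_j$ a $\sigma$-finite (non-negative) measure on its Borel $\sigma$-algebra, $M'_j\subset M_j$ compact, $Q_j\subset M'_j$ a fixed system of $n_j$ points, $I_j=I_{Q_j}$. For every $i=1,\dots,l$ let $(N_i,\nu_i)$ be a space with $\sigma$-finite measure. For all $i,j$ let $A_{ij}:B_{\mu_j}(M'_j)\to\mathfrak{M}(N_i,\nu_i)$ be an integral operator with non-negative kernel $K_{ij}$, and let $Y_i\subset\mathfrak{M}(N_i,\nu_i)$ be a normed lattice with $\bigcup_{j=1}^mA_{ij}(B_{\mu_j}(M'_j))\subset Y_i$. For every $j$ let either $W_j=H^{\omega_j}_{\mu_j}(M'_j)$, $\varphi_j=\tau_{\omega_j,Q_j,e_j}$, $L_j=L_{\omega_j,Q_j,e_j}$, or $W_j=\tilde H^{\omega_j}_{\mu_j}(M'_j)$, $\varphi_j=\tilde\tau_{\omega_j,Q_j,e_j}$, $L_j=\tilde L_{\omega_j,Q_j,e_j}$. Then for every $\sigma=\mathrm{diag}(\sigma_1,\dots,\sigma_m)$ with $\sigma_j\in\{-1,1\}$, the method $\Phi=\overline A\sigma\overline L$, where $\overline L=\mathrm{diag}(L_1,\dots,L_m)$, is an optimal method of recovery of the operator $\overline A\sigma$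 on the class $\overline W=W_1\times\dots\times W_m$ based on information $\overline I=\mathrm{diag}(I_1,\dots,I_m)$ with $\overline U=U_1\times\dots\times U_m$-error, and $$\mathcal{E}_\psi(\overline A\sigma;\overline W;\overline I;\overline U)=\mathcal{E}_\psi(\overline A\sigma;\overline W;\overline I;\overline U;\Phi)=\|\overline A\,\overline\varphi\|_\psi,\qquad \overline\varphi=(\varphi_1,\dots,\varphi_m)^T.$$
   Context: $\mathbb{R}_+=[0,\infty)$. A modulus of continuity is a function $\omega:\mathbb{R}_+\to\mathbb{R}_+$ that is continuous, non-decreasing, with $\omega(0)=0$ and $\omega(t'+t'')\le\omega(t')+\omega(t'')$. A norm $\psi$ on $\mathbb{R}^l$ is monotone if $\psi(a)\le\psi(b)$ whenever $0\le a_i\le b_i$ for all $i$. For a $\sigma$-finite measure space $(N,\nu)$, $\mathfrak{M}(N,\nu)$ is the space of $\nu$-measurable, $\nu$-a.e. finite real functions (modulo $\nu$-a.e. equality), ordered by $x'\prec x''$ iff $x'(s)\le x''(s)$ for $\nu$-a.e. $s$. A normed lattice is a real normed space that is a vector lattice and whose norm satisfies: $|x|\prec|y|$ implies $\|x\|\le\|y\|$; a normed lattice $Y\subset\mathfrak{M}(N,\nu)$ carries the inherited order. A linear operator $T:E\to\mathfrak{M}(N,\nu)$, $E$ a linear manifold in $\mathfrak{M}(M,\mu)$, is an integral operator with kernel $K$ if $K(s,t)$ is $\nu\times\mu$-measurable and for every $x\in E$, $Tx(s)=\int_MK(s,t)x(t)\,d\mu(t)$ (Lebesgue integral) for $\nu$-a.e.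 $s\in N$. For a metric space $(M,\rho)$ with Borel measure $\mu$ and compact $M'\subset M$: $B_\mu(M')$ is the set of $\mu$-essentially bounded $x:M\to\mathbb{R}$ with $\mathrm{supp}\,x\subset M'$; $C_\mu(M')=\{y\cdot\chi_{M'}:y:M\to\mathbb{R}\text{ continuous}\}$; $\tilde C_\mu(M')=\{x:M\to\mathbb{R}\text{ continuous}:\mathrm{supp}\,x\subset M'\}$; $H^\omega_\mu(M')=\{x\in C_\mu(M'):|x(t')-x(t'')|\le\omega(\rho(t',t''))\ \forall t',t''\in M'\}$; $\tilde H^\omega_\mu(M')=H^\omega_\mu(M')\cap\tilde C_\mu(M')$. For $Q=\{q_1,\dots,q_n\}\subset M'$ and $e\in\mathbb{R}^n_+$: $I_Qx=(x(q_1),\dots,x(q_n))$; $U_e=[-e_1,e_1]\times\dots\times[-e_n,e_n]$ (with $e_1,\dots,e_n$ the coordinates of $e$); $\tau=\tau_{\omega,Q,e}$ equals $\min_{1\le k\le n}(e_k+\omega(\rho(t,q_k)))$ for $t\in M'$ and $0$ on $M\setminus M'$; $\tilde\tau_{\omega,Q,e}(t)=\min\{\tau(t),\omega(\rho(t,\partial M'))\}$, where $\rho(t,\partial M')=\inf_{s\in\partial M'}\rho(t,s)$ (if $\partial M'=\emptyset$, $\omega(\rho(t,\partial M'))$ is read as $+\infty$). Put $\Pi'_k=\{t\in M':\tau(t)=e_k+\omega(\rho(t,q_k))\}$, $\Pi_1=\Pi'_1$, $\Pi_k=\Pi'_k\setminus\bigcup_{s<k}\Pi_s$; $\tilde\Pi_0=\{t\in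 M':\omega(\rho(t,\partial M'))\le\tau(t)\}$, $\tilde\Pi_k=\Pi_k\setminus\tilde\Pi_0$. Operators $L_{\omega,Q,e},\tilde L_{\omega,Q,e}:\mathbb{R}^n\to B_\mu(M')$: $L_{\omega,Q,e}z=z_k$ on $\Pi_k$ and $0$ on $M\setminus M'$; $\tilde L_{\omega,Q,e}z=z_k$ on $\tilde\Pi_k$, $k\ge1$, and $0$ on $\tilde\Pi_0\cup(M\setminus M')$. Operator matrices: $\overline A=(A_{ij})$ acts by $(\overline A\,\overline x)_i=\sum_jA_{ij}x_j$; $(\overline A\sigma\overline x)_i=\sum_j\sigma_jA_{ij}x_j$; $(\overline A\sigma\overline L\,\overline z)_i=\sum_j\sigma_jA_{ij}L_jz_j$; $\overline I\,\overline x=(I_1x_1,\dots,I_mx_m)$. On $\overline Y=Y_1\times\dots\times Y_l$, $\|\overline y\|_\psi=\psi(\|y_1\|_{Y_1},\dots,\|y_l\|_{Y_l})$. Recovery: let $\overline Z=\mathbb{R}^{n_1}\times\dots\times\mathbb{R}^{n_m}$. A method of recovery is an arbitrary map $\Phi:\overline Z\to\overline Y$. For an operator $T$ on $\overline W$ with values in $\overline Y$, $\mathcal{E}_\psi(T;\overline W;\overline I;\overline U;\Phi)=\sup_{\overline x\in\overline W}\sup_{\overline z\in\overline I\,\overline x+\overline U}\|T\overline x-\Phi\overline z\|_\psi$, and $\mathcal{E}_\psi(T;\overline W;\overline I;\overline U)$ is its infimum over all $\Phi$. A method is optimal if it attains the infimum. *)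

theory Defs
  imports "HOL-Analysis.Analysis"
begin

text \<open>Conventions. The metric spaces of a finite family are values of \<open>'a metric\<close> over one common
  point type and the measure spaces \<open>N\<^sub>i\<close> are values of \<open>'b measure\<close> over one common point type;
  since a disjoint union carries any family, this is no restriction. A function on a metric space
  \<open>M\<close> is an \<open>'a \<Rightarrow> real\<close> of which only the values on \<open>mspace M\<close> matter. The points and
  coordinates usually numbered $1,\dots,n$ are numbered \<open>0,\<dots>,n - 1\<close> here.\<close>

definition modulus_of_continuity :: "(real \<Rightarrow> real) \<Rightarrow> bool" where
  "modulus_of_continuity \<omega> \<longleftrightarrow>
     (\<forall>t\<ge>0. 0 \<le> \<omega> t) \<and> continuous_on {0..} \<omega> \<and> mono_on {0..} \<omega> \<and> \<omega> 0 = 0 \<and>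
     (\<forall>t'\<ge>0. \<forall>t''\<ge>0. \<omega> (t' + t'') \<le> \<omega> t' + \<omega> t'')"

definition is_norm :: "('v::real_vector \<Rightarrow> real) \<Rightarrow> bool" where
  "is_norm \<psi> \<longleftrightarrow>
     (\<forall>a. 0 \<le> \<psi> a) \<and> (\<forall>a. \<psi> a = 0 \<longleftrightarrow> a = 0) \<and>
     (\<forall>c a. \<psi> (c *\<^sub>R a) = \<bar>c\<bar> * \<psi> a) \<and> (\<forall>a b. \<psi> (a + b) \<le> \<psi> a + \<psi> b)"

definition monotone_norm :: "(real ^ 'l \<Rightarrow> real) \<Rightarrow> bool" where
  "monotone_norm \<psi> \<longleftrightarrow>
     is_norm \<psi> \<and> (\<forall>a b. (\<forall>i. 0 \<le> a $ i \<and> a $ i \<le> b $ i) \<longrightarrow> \<psi> a \<le> \<psi> b)"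

text \<open>Elements of $\mathfrak{M}(N,\nu)$ are represented by functions, with \<open>\<nu>\<close>-a.e. equality in
  the role of equality. ``\<open>\<nu>\<close>-measurable'' means measurable for the completed \<open>\<sigma>\<close>-algebra. Real values
  suffice, because an a.e. finite function is a.e. equal to a real-valued one.\<close>

definition Meas :: "'b measure \<Rightarrow> ('b \<Rightarrow> real) set" where
  "Meas N = borel_measurable (completion N)"

definition ae_le :: "'b measure \<Rightarrow> ('b \<Rightarrow> real) \<Rightarrow> ('b \<Rightarrow> real) \<Rightarrow> bool" where
  "ae_le N x y \<longleftrightarrow> (AE s in N. x s \<le> y s)"

definition ae_eq :: "'b measure \<Rightarrow> ('b \<Rightarrow> real) \<Rightarrow> ('b \<Rightarrow> real) \<Rightarrow> bool" where
  "ae_eq N x y \<longleftrightarrow> (AE s in N. x s = y s)"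

text \<open>Suprema and infima are taken in \<open>Y\<close> with the inherited order; they need not be the pointwise
  maxima and minima. The second conjunct of \<open>normed_lattice\<close> makes \<open>Y\<close> a set of a.e. classes and
  \<open>nrm\<close> a function on classes.\<close>

definition is_sup_in ::
  "'b measure \<Rightarrow> ('b \<Rightarrow> real) set \<Rightarrow> ('b \<Rightarrow> real) \<Rightarrow> ('b \<Rightarrow> real) \<Rightarrow> ('b \<Rightarrow> real) \<Rightarrow> bool" where
  "is_sup_in N Y x y u \<longleftrightarrow>
     u \<in> Y \<and> ae_le N x u \<and> ae_le N y u \<and>
     (\<forall>v\<in>Y. ae_le N x v \<and> ae_le N y v \<longrightarrow> ae_le N u v)"

definition is_inf_in ::
  "'b measure \<Rightarrow> ('b \<Rightarrow> real) set \<Rightarrow> ('b \<Rightarrow> real) \<Rightarrow> ('b \<Rightarrow> real) \<Rightarrow> ('b \<Rightarrow> real) \<Rightarrow> bool" where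
  "is_inf_in N Y x y u \<longleftrightarrow>
     u \<in> Y \<and> ae_le N u x \<and> ae_le N u y \<and>
     (\<forall>v\<in>Y. ae_le N v x \<and> ae_le N v y \<longrightarrow> ae_le N v u)"

definition is_abs_in ::
  "'b measure \<Rightarrow> ('b \<Rightarrow> real) set \<Rightarrow> ('b \<Rightarrow> real) \<Rightarrow> ('b \<Rightarrow> real) \<Rightarrow> bool" where
  "is_abs_in N Y x u \<longleftrightarrow> is_sup_in N Y x (\<lambda>s. - x s) u"

definition normed_lattice ::
  "'b measure \<Rightarrow> ('b \<Rightarrow> real) set \<Rightarrow> (('b \<Rightarrow> real) \<Rightarrow> real) \<Rightarrow> bool" where
  "normed_lattice N Y nrm \<longleftrightarrow>
     Y \<subseteq> Meas N \<and>
     (\<forall>x\<in>Y. \<forall>y\<in>Meas N. ae_eq N x y \<longrightarrow> y \<in> Y \<and> nrm x = nrm y) \<and>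
     (\<lambda>s. 0) \<in> Y \<and>
     (\<forall>x\<in>Y. \<forall>y\<in>Y. (\<lambda>s. x s + y s) \<in> Y) \<and>
     (\<forall>c. \<forall>x\<in>Y. (\<lambda>s. c * x s) \<in> Y) \<and>
     (\<forall>x\<in>Y. 0 \<le> nrm x) \<and>
     (\<forall>x\<in>Y. nrm x = 0 \<longleftrightarrow> ae_eq N x (\<lambda>s. 0)) \<and>
     (\<forall>c. \<forall>x\<in>Y. nrm (\<lambda>s. c * x s) = \<bar>c\<bar> * nrm x) \<and>
     (\<forall>x\<in>Y. \<forall>y\<in>Y. nrm (\<lambda>s. x s + y s) \<le> nrm x + nrm y) \<and>
     (\<forall>x\<in>Y. \<forall>y\<in>Y. (\<exists>u. is_sup_in N Y x y u) \<and> (\<exists>u. is_inf_in N Y x y u)) \<and>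
     (\<forall>x\<in>Y. \<forall>y\<in>Y. \<forall>u v. is_abs_in N Y x u \<and> is_abs_in N Y y v \<and> ae_le N u v
        \<longrightarrow> nrm x \<le> nrm y)"

definition integral_operator ::
  "'a measure \<Rightarrow> 'b measure \<Rightarrow> ('a \<Rightarrow> real) set \<Rightarrow> ('b \<Rightarrow> 'a \<Rightarrow> real)
     \<Rightarrow> (('a \<Rightarrow> real) \<Rightarrow> 'b \<Rightarrow> real) \<Rightarrow> bool" where
  "integral_operator \<mu> N E K T \<longleftrightarrow>
     (\<forall>x\<in>E. T x \<in> Meas N) \<and>
     (\<forall>x\<in>E. \<forall>y\<in>E. ae_eq N (T (\<lambda>t. x t + y t)) (\<lambda>s. T x s + T y s)) \<and>
     (\<forall>c. \<forall>x\<in>E. ae_eq N (T (\<lambda>t. c * x t)) (\<lambda>s. c * T x s)) \<and>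
     (\<lambda>(s, t). K s t) \<in> borel_measurable (completion (N \<Otimes>\<^sub>M \<mu>)) \<and>
     (\<forall>x\<in>E. AE s in N. integrable (completion \<mu>) (\<lambda>t. K s t * x t) \<and>
        T x s = (\<integral>t. K s t * x t \<partial>completion \<mu>))"

definition nonneg_kernel :: "'a measure \<Rightarrow> 'b measure \<Rightarrow> ('b \<Rightarrow> 'a \<Rightarrow> real) \<Rightarrow> bool" where
  "nonneg_kernel \<mu> N K \<longleftrightarrow> (AE (s, t) in N \<Otimes>\<^sub>M \<mu>. 0 \<le> K s t)"

definition is_borel_measure :: "'a metric \<Rightarrow> 'a measure \<Rightarrow> bool" where
  "is_borel_measure M \<mu> \<longleftrightarrow>
     sets \<mu> = sets (sigma (mspace M) {U. openin (mtopology_of M) U})"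

definition supp :: "'a metric \<Rightarrow> ('a \<Rightarrow> real) \<Rightarrow> 'a set" where
  "supp M x = (mtopology_of M) closure_of {t \<in> mspace M. x t \<noteq> 0}"

definition B_class :: "'a metric \<Rightarrow> 'a measure \<Rightarrow> 'a set \<Rightarrow> ('a \<Rightarrow> real) set" where
  "B_class M \<mu> M' =
     {x \<in> Meas \<mu>. (\<exists>c. AE t in \<mu>. \<bar>x t\<bar> \<le> c) \<and> supp M x \<subseteq> M'}"

definition C_class :: "'a metric \<Rightarrow> 'a set \<Rightarrow> ('a \<Rightarrow> real) set" where
  "C_class M M' =
     {x. \<exists>y. continuous_map (mtopology_of M) euclideanreal y \<and>
             (\<forall>t\<in>mspace M. x t = y t * indicator M' t)}"

definition C_tilde_class :: "'a metric \<Rightarrow> 'a set \<Rightarrow> ('a \<Rightarrow> real) set" where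
  "C_tilde_class M M' =
     {x. continuous_map (mtopology_of M) euclideanreal x \<and> supp M x \<subseteq> M'}"

definition H_class :: "(real \<Rightarrow> real) \<Rightarrow> 'a metric \<Rightarrow> 'a set \<Rightarrow> ('a \<Rightarrow> real) set" where
  "H_class \<omega> M M' =
     {x \<in> C_class M M'. \<forall>t'\<in>M'. \<forall>t''\<in>M'. \<bar>x t' - x t''\<bar> \<le> \<omega> (mdist M t' t'')}"

definition H_tilde_class :: "(real \<Rightarrow> real) \<Rightarrow> 'a metric \<Rightarrow> 'a set \<Rightarrow> ('a \<Rightarrow> real) set" where
  "H_tilde_class \<omega> M M' = H_class \<omega> M M' \<inter> C_tilde_class M M'"

text \<open>\<open>\<real>\<^sup>n\<close> is the set of sequences vanishing from index \<open>n\<close> on, so that \<open>n\<close> may vary within a finite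
  family. A system \<open>q\<^sub>0, \<dots>, q\<^bsub>n - 1\<^esub>\<close> of points is a function of which only the values below \<open>n\<close>
  matter.\<close>

definition Rvec :: "nat \<Rightarrow> (nat \<Rightarrow> real) set" where
  "Rvec n = {z. \<forall>k\<ge>n. z k = 0}"

definition info :: "nat \<Rightarrow> (nat \<Rightarrow> 'a) \<Rightarrow> ('a \<Rightarrow> real) \<Rightarrow> nat \<Rightarrow> real" where
  "info n q x = (\<lambda>k. if k < n then x (q k) else 0)"

definition U_box :: "nat \<Rightarrow> (nat \<Rightarrow> real) \<Rightarrow> (nat \<Rightarrow> real) set" where
  "U_box n e = {u \<in> Rvec n. \<forall>k<n. u k \<in> {- e k..e k}}"

definition tau ::
  "'a metric \<Rightarrow> 'a set \<Rightarrow> (real \<Rightarrow> real) \<Rightarrow> nat \<Rightarrow> (nat \<Rightarrow> 'a) \<Rightarrow> (nat \<Rightarrow> real) \<Rightarrow> 'a \<Rightarrow> real" where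
  "tau M M' \<omega> n q e t =
     (if t \<in> M' then Min ((\<lambda>k. e k + \<omega> (mdist M t (q k))) ` {..<n}) else 0)"

abbreviation bdry :: "'a metric \<Rightarrow> 'a set \<Rightarrow> 'a set" where
  "bdry M M' \<equiv> (mtopology_of M) frontier_of M'"

definition bdry_dist :: "'a metric \<Rightarrow> 'a set \<Rightarrow> 'a \<Rightarrow> real" where
  "bdry_dist M M' t = (INF s\<in>bdry M M'. mdist M t s)"

text \<open>If the boundary is empty, \<open>\<omega> (\<rho>(t, \<partial>M'))\<close> counts as \<open>+\<infinity>\<close>, which the case distinctions below
  on \<open>bdry M M' = {}\<close> express.\<close>

definition tau_tilde ::
  "'a metric \<Rightarrow> 'a set \<Rightarrow> (real \<Rightarrow> real) \<Rightarrow> nat \<Rightarrow> (nat \<Rightarrow> 'a) \<Rightarrow> (nat \<Rightarrow> real) \<Rightarrow> 'a \<Rightarrow> real" where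
  "tau_tilde M M' \<omega> n q e t =
     (if bdry M M' = {} then tau M M' \<omega> n q e t
      else min (tau M M' \<omega> n q e t) (\<omega> (bdry_dist M M' t)))"

definition Pi_prime ::
  "'a metric \<Rightarrow> 'a set \<Rightarrow> (real \<Rightarrow> real) \<Rightarrow> nat \<Rightarrow> (nat \<Rightarrow> 'a) \<Rightarrow> (nat \<Rightarrow> real) \<Rightarrow> nat \<Rightarrow> 'a set" where
  "Pi_prime M M' \<omega> n q e k =
     {t \<in> M'. tau M M' \<omega> n q e t = e k + \<omega> (mdist M t (q k))}"

fun Pi_part ::
  "'a metric \<Rightarrow> 'a set \<Rightarrow> (real \<Rightarrow> real) \<Rightarrow> nat \<Rightarrow> (nat \<Rightarrow> 'a) \<Rightarrow> (nat \<Rightarrow> real) \<Rightarrow> nat \<Rightarrow> 'a set" where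
  "Pi_part M M' \<omega> n q e k =
     Pi_prime M M' \<omega> n q e k - (\<Union>s\<in>{..<k}. Pi_part M M' \<omega> n q e s)"

declare Pi_part.simps [simp del]

definition Pi_tilde_zero ::
  "'a metric \<Rightarrow> 'a set \<Rightarrow> (real \<Rightarrow> real) \<Rightarrow> nat \<Rightarrow> (nat \<Rightarrow> 'a) \<Rightarrow> (nat \<Rightarrow> real) \<Rightarrow> 'a set" where
  "Pi_tilde_zero M M' \<omega> n q e =
     {t \<in> M'. bdry M M' \<noteq> {} \<and> \<omega> (bdry_dist M M' t) \<le> tau M M' \<omega> n q e t}"

definition Pi_tilde ::
  "'a metric \<Rightarrow> 'a set \<Rightarrow> (real \<Rightarrow> real) \<Rightarrow> nat \<Rightarrow> (nat \<Rightarrow> 'a) \<Rightarrow> (nat \<Rightarrow> real) \<Rightarrow> nat \<Rightarrow> 'a set" where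
  "Pi_tilde M M' \<omega> n q e k = Pi_part M M' \<omega> n q e k - Pi_tilde_zero M M' \<omega> n q e"

text \<open>The sets \<open>Pi_part \<dots> k\<close> are pairwise disjoint, so the sums below pick out the one \<open>z k\<close>
  belonging to the set that contains \<open>t\<close>.\<close>

definition L_op ::
  "'a metric \<Rightarrow> 'a set \<Rightarrow> (real \<Rightarrow> real) \<Rightarrow> nat \<Rightarrow> (nat \<Rightarrow> 'a) \<Rightarrow> (nat \<Rightarrow> real)
     \<Rightarrow> (nat \<Rightarrow> real) \<Rightarrow> 'a \<Rightarrow> real" where
  "L_op M M' \<omega> n q e z t = (\<Sum>k<n. z k * indicator (Pi_part M M' \<omega> n q e k) t)"

definition L_tilde_op ::
  "'a metric \<Rightarrow> 'a set \<Rightarrow> (real \<Rightarrow> real) \<Rightarrow> nat \<Rightarrow> (nat \<Rightarrow> 'a) \<Rightarrow> (nat \<Rightarrow> real)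
     \<Rightarrow> (nat \<Rightarrow> real) \<Rightarrow> 'a \<Rightarrow> real" where
  "L_tilde_op M M' \<omega> n q e z t = (\<Sum>k<n. z k * indicator (Pi_tilde M M' \<omega> n q e k) t)"

definition mat_op ::
  "('l \<Rightarrow> 'm::finite \<Rightarrow> ('a \<Rightarrow> real) \<Rightarrow> 'b \<Rightarrow> real) \<Rightarrow> ('m \<Rightarrow> 'a \<Rightarrow> real) \<Rightarrow> 'l \<Rightarrow> 'b \<Rightarrow> real" where
  "mat_op A x = (\<lambda>i s. \<Sum>j\<in>UNIV. A i j (x j) s)"

definition mat_sigma_op ::
  "('l \<Rightarrow> 'm::finite \<Rightarrow> ('a \<Rightarrow> real) \<Rightarrow> 'b \<Rightarrow> real) \<Rightarrow> ('m \<Rightarrow> real)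
     \<Rightarrow> ('m \<Rightarrow> 'a \<Rightarrow> real) \<Rightarrow> 'l \<Rightarrow> 'b \<Rightarrow> real" where
  "mat_sigma_op A \<sigma> x = (\<lambda>i s. \<Sum>j\<in>UNIV. \<sigma> j * A i j (x j) s)"

definition diag_op :: "('m \<Rightarrow> 'x \<Rightarrow> 'y) \<Rightarrow> ('m \<Rightarrow> 'x) \<Rightarrow> 'm \<Rightarrow> 'y" where
  "diag_op D x = (\<lambda>j. D j (x j))"

definition norm_psi ::
  "(real ^ 'l \<Rightarrow> real) \<Rightarrow> ('l::finite \<Rightarrow> ('b \<Rightarrow> real) \<Rightarrow> real) \<Rightarrow> ('l \<Rightarrow> 'b \<Rightarrow> real) \<Rightarrow> real" where
  "norm_psi \<psi> nrm y = \<psi> (\<chi> i. nrm i (y i))"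

definition noisy_info ::
  "(('m \<Rightarrow> 'a \<Rightarrow> real) \<Rightarrow> 'm \<Rightarrow> nat \<Rightarrow> real) \<Rightarrow> ('m \<Rightarrow> nat \<Rightarrow> real) set
     \<Rightarrow> ('m \<Rightarrow> 'a \<Rightarrow> real) \<Rightarrow> ('m \<Rightarrow> nat \<Rightarrow> real) set" where
  "noisy_info II UU x = {\<lambda>j k. II x j k + u j k | u. u \<in> UU}"

text \<open>Errors take values in \<open>ereal\<close>, since the error of an arbitrary method may be infinite.\<close>

definition method_error ::
  "(real ^ 'l \<Rightarrow> real) \<Rightarrow> ('l::finite \<Rightarrow> ('b \<Rightarrow> real) \<Rightarrow> real)
     \<Rightarrow> (('m \<Rightarrow> 'a \<Rightarrow> real) \<Rightarrow> 'l \<Rightarrow> 'b \<Rightarrow> real) \<Rightarrow> ('m \<Rightarrow> 'a \<Rightarrow> real) set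
     \<Rightarrow> (('m \<Rightarrow> 'a \<Rightarrow> real) \<Rightarrow> 'm \<Rightarrow> nat \<Rightarrow> real) \<Rightarrow> ('m \<Rightarrow> nat \<Rightarrow> real) set
     \<Rightarrow> (('m \<Rightarrow> nat \<Rightarrow> real) \<Rightarrow> 'l \<Rightarrow> 'b \<Rightarrow> real) \<Rightarrow> ereal" where
  "method_error \<psi> nrm T WW II UU \<Phi> =
     (SUP x\<in>WW. SUP z\<in>noisy_info II UU x. ereal (norm_psi \<psi> nrm (\<lambda>i s. T x i s - \<Phi> z i s)))"

text \<open>Methods are the arbitrary maps \<open>ZZ \<rightarrow> YY\<close>; values outside \<open>ZZ\<close> are irrelevant.\<close>

definition optimal_error ::
  "(real ^ 'l \<Rightarrow> real) \<Rightarrow> ('l::finite \<Rightarrow> ('b \<Rightarrow> real) \<Rightarrow> real)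
     \<Rightarrow> ('m \<Rightarrow> nat \<Rightarrow> real) set \<Rightarrow> ('l \<Rightarrow> 'b \<Rightarrow> real) set
     \<Rightarrow> (('m \<Rightarrow> 'a \<Rightarrow> real) \<Rightarrow> 'l \<Rightarrow> 'b \<Rightarrow> real) \<Rightarrow> ('m \<Rightarrow> 'a \<Rightarrow> real) set
     \<Rightarrow> (('m \<Rightarrow> 'a \<Rightarrow> real) \<Rightarrow> 'm \<Rightarrow> nat \<Rightarrow> real) \<Rightarrow> ('m \<Rightarrow> nat \<Rightarrow> real) set \<Rightarrow> ereal" where
  "optimal_error \<psi> nrm ZZ YY T WW II UU =
     (INF \<Phi>\<in>ZZ \<rightarrow> YY. method_error \<psi> nrm T WW II UU \<Phi>)"

definition optimal_method ::
  "(real ^ 'l \<Rightarrow> real) \<Rightarrow> ('l::finite \<Rightarrow> ('b \<Rightarrow> real) \<Rightarrow> real)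
     \<Rightarrow> ('m \<Rightarrow> nat \<Rightarrow> real) set \<Rightarrow> ('l \<Rightarrow> 'b \<Rightarrow> real) set
     \<Rightarrow> (('m \<Rightarrow> 'a \<Rightarrow> real) \<Rightarrow> 'l \<Rightarrow> 'b \<Rightarrow> real) \<Rightarrow> ('m \<Rightarrow> 'a \<Rightarrow> real) set
     \<Rightarrow> (('m \<Rightarrow> 'a \<Rightarrow> real) \<Rightarrow> 'm \<Rightarrow> nat \<Rightarrow> real) \<Rightarrow> ('m \<Rightarrow> nat \<Rightarrow> real) set
     \<Rightarrow> (('m \<Rightarrow> nat \<Rightarrow> real) \<Rightarrow> 'l \<Rightarrow> 'b \<Rightarrow> real) \<Rightarrow> bool" where
  "optimal_method \<psi> nrm ZZ YY T WW II UU \<Phi> \<longleftrightarrow>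
     \<Phi> \<in> ZZ \<rightarrow> YY \<and>
     method_error \<psi> nrm T WW II UU \<Phi> = optimal_error \<psi> nrm ZZ YY T WW II UU"

end

theory Submission
  imports Defs
begin

text \<open>
  If \<open>z\<close> is noisy information about \<open>x \<in> W\<^sub>j\<close>, then \<open>|x - L\<^sub>j z| \<le> \<phi>\<^sub>j\<close> pointwise: \<open>L\<^sub>j z\<close> copies at each
  point the observed value at the sample point that realises the minimum in \<open>\<tau>\<close>, or the value \<open>0\<close> which
  \<open>x\<close> takes on the boundary when that gives the better bound. A non-negative kernel turns this into
  \<open>|A\<^sub>i\<^sub>j x - A\<^sub>i\<^sub>j (L\<^sub>j z)| \<le> A\<^sub>i\<^sub>j \<phi>\<^sub>j\<close>, and the lattice norms and the monotone norm \<open>\<psi>\<close> preserve the inequality.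
  Conversely \<open>\<phi>\<^sub>j\<close> and \<open>- \<phi>\<^sub>j\<close> belong to \<open>W\<^sub>j\<close> and are both compatible with the information \<open>0\<close>, so no
  method can have an error below \<open>\<parallel>A \<phi>\<parallel>\<close>.
\<close>

subsection \<open>Functions dominated by a modulus of continuity\<close>

lemma modulus_small:
  assumes "modulus_of_continuity \<omega>" "\<epsilon> > 0"
  obtains \<delta> where "\<delta> > 0" "\<And>d. 0 \<le> d \<Longrightarrow> d < \<delta> \<Longrightarrow> \<omega> d < \<epsilon>"
proof -
  have "continuous_on {0..} \<omega>" "\<omega> 0 = 0"
    using assms(1) by (auto simp: modulus_of_continuity_def)
  then obtain \<delta> where "\<delta> > 0" and \<delta>: "\<And>d. d \<in> {0..} \<Longrightarrow> dist d 0 < \<delta> \<Longrightarrow> dist (\<omega> d) 0 < \<epsilon>"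
    using assms(2) unfolding continuous_on_iff by (metis atLeast_iff order_refl)
  show thesis
  proof (rule that)
    fix d :: real assume "0 \<le> d" "d < \<delta>"
    then show "\<omega> d < \<epsilon>" using \<delta>[of d] by (simp add: dist_real_def)
  qed fact
qed

lemma mdist_self: "t \<in> mspace M \<Longrightarrow> mdist M t t = 0"
  by simp

text \<open>The inequality is one-sided because this form passes to minima in one estimate;
  exchanging \<open>s\<close> and \<open>t\<close> restores the absolute value. It ranges over the
  whole space rather than \<open>M'\<close>, since \<open>C_class\<close> asks for a witness
  continuous on all of \<open>M\<close>.\<close>

definition omega_lipschitz :: "(real \<Rightarrow> real) \<Rightarrow> 'a metric \<Rightarrow> ('a \<Rightarrow> real) \<Rightarrow> bool" where
  "omega_lipschitz \<omega> M f \<longleftrightarrow> (\<forall>s\<in>mspace M. \<forall>t\<in>mspace M. f s \<le> f t + \<omega> (mdist M s t))"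

lemma omega_lipschitz_abs:
  assumes "omega_lipschitz \<omega> M f" "s \<in> mspace M" "t \<in> mspace M"
  shows "\<bar>f s - f t\<bar> \<le> \<omega> (mdist M s t)"
proof -
  have "f s \<le> f t + \<omega> (mdist M s t)" "f t \<le> f s + \<omega> (mdist M t s)"
    using assms by (auto simp: omega_lipschitz_def)
  then show ?thesis by (simp add: mdist_commute[of M t s])
qed

lemma omega_lipschitz_min:
  assumes "omega_lipschitz \<omega> M f" "omega_lipschitz \<omega> M g"
  shows "omega_lipschitz \<omega> M (\<lambda>t. min (f t) (g t))"
  using assms by (fastforce simp: omega_lipschitz_def min_def)

text \<open>The index that realises the minimum at \<open>t\<close> also bounds the minimum at
  \<open>s\<close> from above.\<close>

lemma omega_lipschitz_Min:
  assumes "finite I" "I \<noteq> {}" "\<And>k. k \<in> I \<Longrightarrow> omega_lipschitz \<omega> M (f k)"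
  shows "omega_lipschitz \<omega> M (\<lambda>t. Min ((\<lambda>k. f k t) ` I))"
  unfolding omega_lipschitz_def
proof (intro ballI)
  fix s t assume st: "s \<in> mspace M" "t \<in> mspace M"
  have "Min ((\<lambda>k. f k t) ` I) \<in> (\<lambda>k. f k t) ` I"
    using assms by (intro Min_in) auto
  then obtain k where k: "k \<in> I" "Min ((\<lambda>k. f k t) ` I) = f k t" by auto
  have "Min ((\<lambda>k. f k s) ` I) \<le> f k s" using k assms by (intro Min_le) auto
  also have "\<dots> \<le> f k t + \<omega> (mdist M s t)"
    using assms(3)[OF k(1)] st by (auto simp: omega_lipschitz_def)
  finally show "Min ((\<lambda>k. f k s) ` I) \<le> Min ((\<lambda>k. f k t) ` I) + \<omega> (mdist M s t)"
    using k by simp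
qed

text \<open>Monotonicity of \<omega> carries over the 1-Lipschitz bound on \<open>h\<close>, and
  subadditivity splits the resulting sum. Here \<open>h\<close> will be the distance to a sample
  point or to the boundary.\<close>

lemma omega_lipschitz_modulus_comp:
  assumes "modulus_of_continuity \<omega>" "\<And>t. t \<in> mspace M \<Longrightarrow> 0 \<le> h t"
    and "\<And>s t. s \<in> mspace M \<Longrightarrow> t \<in> mspace M \<Longrightarrow> h s \<le> h t + mdist M s t"
  shows "omega_lipschitz \<omega> M (\<lambda>t. \<omega> (h t))"
  unfolding omega_lipschitz_def
proof (intro ballI)
  fix s t assume st: "s \<in> mspace M" "t \<in> mspace M"
  have "\<omega> (h s) \<le> \<omega> (h t + mdist M s t)"
    using assms st by (auto simp: modulus_of_continuity_def intro!: mono_onD[of "{0..}" \<omega>])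
  also have "\<dots> \<le> \<omega> (h t) + \<omega> (mdist M s t)"
    using assms st by (auto simp: modulus_of_continuity_def)
  finally show "\<omega> (h s) \<le> \<omega> (h t) + \<omega> (mdist M s t)" .
qed

text \<open>Since \<omega> is small near 0, a ball of radius \<delta> about \<open>t\<close> is
  mapped into the \<epsilon>-ball about \<open>f t\<close>.\<close>

lemma omega_lipschitz_continuous:
  assumes "modulus_of_continuity \<omega>" "omega_lipschitz \<omega> M f"
  shows "continuous_map (mtopology_of M) euclideanreal f"
proof -
  have "continuous_map (mtopology_of M) (Met_TC.mtopology) f"
    unfolding Met_TC.continuous_map_to_metric
  proof (intro ballI allI impI)
    fix t and \<epsilon> :: real
    assume t: "t \<in> topspace (mtopology_of M)" and "\<epsilon> > 0"
    then obtain \<delta> where \<delta>: "\<delta> > 0" "\<And>d. 0 \<le> d \<Longrightarrow> d < \<delta> \<Longrightarrow> \<omega> d < \<epsilon>"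
      using modulus_small[OF assms(1)] by metis
    have "openin (mtopology_of M) (mball_of M t \<delta>)"
      by (simp add: mtopology_of_def mball_of_def Metric_space.openin_mball)
    moreover have "f s \<in> Met_TC.mball (f t) \<epsilon>" if "s \<in> mball_of M t \<delta>" for s
      using that \<delta>(2)[of "mdist M t s"] omega_lipschitz_abs[OF assms(2), of t s]
      by (simp add: dist_real_def)
    moreover have self: "mdist M t t < \<delta>" using t \<delta>(1) mdist_self[of t M] by (metis topspace_mtopology_of)
    ultimately show "\<exists>U. openin (mtopology_of M) U \<and> t \<in> U \<and> (\<forall>s\<in>U. f s \<in> Met_TC.mball (f t) \<epsilon>)"
      using t self by (intro exI[of _ "mball_of M t \<delta>"]) auto
  qed
  then show ?thesis by simp
qed

subsection \<open>Borel measures and the function classes\<close>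

lemma space_borel_measure:
  assumes "is_borel_measure M \<mu>"
  shows "space \<mu> = mspace M"
proof -
  have "{U. openin (mtopology_of M) U} \<subseteq> Pow (mspace M)"
    using openin_subset by fastforce
  then show ?thesis
    using sets_eq_imp_space_eq[of \<mu> "sigma (mspace M) {U. openin (mtopology_of M) U}"] assms
    by (simp add: is_borel_measure_def)
qed

lemma openin_sets_borel_measure:
  assumes "is_borel_measure M \<mu>" "openin (mtopology_of M) U"
  shows "U \<in> sets \<mu>"
proof -
  have "{U. openin (mtopology_of M) U} \<subseteq> Pow (mspace M)"
    using openin_subset by fastforce
  then show ?thesis using assms by (simp add: is_borel_measure_def)
qed

lemma closedin_sets_borel_measure:
  assumes "is_borel_measure M \<mu>" "closedin (mtopology_of M) S"
  shows "S \<in> sets \<mu>"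
proof -
  have "mspace M - S \<in> sets \<mu>"
    using assms by (auto intro!: openin_sets_borel_measure simp: closedin_def)
  then have "space \<mu> - (mspace M - S) \<in> sets \<mu>" by blast
  moreover have "space \<mu> - (mspace M - S) = S"
    using assms closedin_subset space_borel_measure[OF assms(1)] by fastforce
  ultimately show ?thesis by simp
qed

lemma continuous_map_borel_measurable:
  assumes "is_borel_measure M \<mu>" "continuous_map (mtopology_of M) euclideanreal f"
  shows "f \<in> borel_measurable \<mu>"
proof (rule borel_measurableI)
  fix S :: "real set" assume "open S"
  then have "openin (mtopology_of M) {t \<in> mspace M. f t \<in> S}"
    using assms(2) by (auto simp: continuous_map_def)
  moreover have "f -` S \<inter> space \<mu> = {t \<in> mspace M. f t \<in> S}"
    using space_borel_measure[OF assms(1)] by auto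
  ultimately show "f -` S \<inter> space \<mu> \<in> sets \<mu>"
    using openin_sets_borel_measure[OF assms(1)] by simp
qed

lemma B_classI:
  assumes \<mu>: "is_borel_measure M \<mu>" and cl: "closedin (mtopology_of M) M'"
    and f: "f \<in> borel_measurable \<mu>"
    and bd: "\<And>t. t \<in> mspace M \<Longrightarrow> \<bar>f t\<bar> \<le> c"
    and zero: "\<And>t. t \<in> mspace M \<Longrightarrow> t \<notin> M' \<Longrightarrow> f t = 0"
  shows "f \<in> B_class M \<mu> M'"
proof -
  have "AE t in \<mu>. \<bar>f t\<bar> \<le> c"
    by (rule AE_I2) (simp add: space_borel_measure[OF \<mu>] bd)
  moreover have "supp M f \<subseteq> M'"
    unfolding supp_def using zero cl by (intro closure_of_minimal) auto
  ultimately show ?thesis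
    using f by (auto simp: B_class_def Meas_def measurable_completion)
qed

text \<open>Compactness bounds the continuous witness on \<open>M'\<close>, and closedness makes the
  cut-off at \<open>M'\<close> measurable.\<close>

lemma C_class_subset_B_class:
  assumes \<mu>: "is_borel_measure M \<mu>" and cpt: "compactin (mtopology_of M) M'"
    and cl: "closedin (mtopology_of M) M'"
  shows "C_class M M' \<subseteq> B_class M \<mu> M'"
proof
  fix x assume "x \<in> C_class M M'"
  then obtain y where y: "continuous_map (mtopology_of M) euclideanreal y"
    and xy: "\<And>t. t \<in> mspace M \<Longrightarrow> x t = y t * indicator M' t"
    by (auto simp: C_class_def)
  have "compactin euclideanreal (y ` M')"
    using image_compactin[OF cpt y] .
  then have "bounded (y ` M')" by (simp add: compact_imp_bounded)
  then obtain c where c: "\<And>t. t \<in> M' \<Longrightarrow> \<bar>y t\<bar> \<le> c"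
    by (auto simp: bounded_real)
  have "(\<lambda>t. y t * indicator M' t) \<in> borel_measurable \<mu>"
    using continuous_map_borel_measurable[OF \<mu> y] closedin_sets_borel_measure[OF \<mu> cl] by simp
  then have "x \<in> borel_measurable \<mu>"
    using xy space_borel_measure[OF \<mu>] by (subst measurable_cong) auto
  then show "x \<in> B_class M \<mu> M'"
    \<comment> \<open>\<open>c\<close> bounds the witness only on \<open>M'\<close> and may be
      negative when \<open>M'\<close> is empty; the maximum with 0 also covers the points outside
      \<open>M'\<close>.\<close>
    using c xy by (intro B_classI[OF \<mu> cl, of x "max c 0"]) (fastforce simp: indicator_def max_def)+
qed

text \<open>The zero set is closed and contains the complement of \<open>S\<close>, hence also the
  closure of that complement, in which the frontier lies.\<close>

lemma continuous_map_zero_on_frontier: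
  assumes x: "continuous_map X euclideanreal x"
    and zero: "\<And>t. t \<in> topspace X \<Longrightarrow> t \<notin> S \<Longrightarrow> x t = 0"
    and s: "s \<in> X frontier_of S"
  shows "x s = 0"
proof -
  have "closedin X {t \<in> topspace X. x t \<in> {0}}"
    using x by (intro closedin_continuous_map_preimage[of X euclideanreal]) auto
  then have "X closure_of (topspace X - S) \<subseteq> {t \<in> topspace X. x t \<in> {0}}"
    using zero by (intro closure_of_minimal) auto
  then show ?thesis using s by (auto simp: frontier_of_closures)
qed

text \<open>This symmetry of the class lets \<phi> serve with either sign as a worst-case input for
  the lower bound.\<close>

lemma H_class_sign:
  assumes "x \<in> H_class \<omega> M M'" "c \<in> {-1, 1}"
  shows "(\<lambda>t. c * x t) \<in> H_class \<omega> M M'"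
proof -
  obtain y where y: "continuous_map (mtopology_of M) euclideanreal y"
    "\<And>t. t \<in> mspace M \<Longrightarrow> x t = y t * indicator M' t"
    using assms by (auto simp: H_class_def C_class_def)
  have "continuous_map (mtopology_of M) euclideanreal (\<lambda>t. c * y t)"
    using y(1) by (intro continuous_intros) auto
  then have "(\<lambda>t. c * x t) \<in> C_class M M'"
    unfolding C_class_def using y(2) by (auto intro!: exI[of _ "\<lambda>t. c * y t"])
  then show ?thesis
    using assms by (auto simp: H_class_def abs_minus_commute)
qed

lemma H_tilde_class_sign:
  assumes "x \<in> H_tilde_class \<omega> M M'" "c \<in> {-1, 1}"
  shows "(\<lambda>t. c * x t) \<in> H_tilde_class \<omega> M M'"
proof -
  have "continuous_map (mtopology_of M) euclideanreal (\<lambda>t. c * x t)"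
    using assms by (intro continuous_intros) (auto simp: H_tilde_class_def C_tilde_class_def)
  moreover have "supp M (\<lambda>t. c * x t) = supp M x"
    using assms(2) by (auto simp: supp_def)
  ultimately show ?thesis
    using assms H_class_sign[of x \<omega> M M' c] by (auto simp: H_tilde_class_def C_tilde_class_def)
qed

subsection \<open>Recovery of a single function from noisy samples\<close>

locale sampling =
  fixes M :: "'a metric" and M' :: "'a set" and \<omega> :: "real \<Rightarrow> real"
    and n :: nat and q :: "nat \<Rightarrow> 'a" and e :: "nat \<Rightarrow> real"
  assumes n: "n \<ge> 1"
    and modulus: "modulus_of_continuity \<omega>"
    and e: "k < n \<Longrightarrow> 0 \<le> e k"
    and compact: "compactin (mtopology_of M) M'"
    and q: "k < n \<Longrightarrow> q k \<in> M'"
begin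

abbreviation "\<tau> \<equiv> tau M M' \<omega> n q e"
abbreviation "\<tau>t \<equiv> tau_tilde M M' \<omega> n q e"

text \<open>This is \<tau> without the cut-off at \<open>M'\<close>. Unlike \<tau>, which may jump
  at the boundary, it is continuous on the whole space.\<close>

definition envelope :: "'a \<Rightarrow> real" where
  "envelope t = Min ((\<lambda>k. e k + \<omega> (mdist M t (q k))) ` {..<n})"

lemma closed: "closedin (mtopology_of M) M'"
proof -
  have "Hausdorff_space (mtopology_of M)"
    by (simp add: mtopology_of_def Metric_space.Hausdorff_space_mtopology)
  then show ?thesis using compact by (rule compactin_imp_closedin)
qed

lemma M'_subset: "M' \<subseteq> mspace M"
  using closed closedin_subset by fastforce

lemma bdry_subset: "bdry M M' \<subseteq> M'"
  using closed by (rule frontier_of_subset_closedin)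

lemma modulus_nonneg: "0 \<le> t \<Longrightarrow> 0 \<le> \<omega> t"
  using modulus by (simp add: modulus_of_continuity_def)

lemma modulus_zero: "\<omega> 0 = 0"
  using modulus by (simp add: modulus_of_continuity_def)

lemma envelope_le: "k < n \<Longrightarrow> envelope t \<le> e k + \<omega> (mdist M t (q k))"
  unfolding envelope_def by (intro Min_le) auto

lemma envelope_attained:
  obtains k where "k < n" "envelope t = e k + \<omega> (mdist M t (q k))"
proof -
  have "envelope t \<in> (\<lambda>k. e k + \<omega> (mdist M t (q k))) ` {..<n}"
    unfolding envelope_def using n by (intro Min_in) (auto simp: lessThan_empty_iff)
  then show thesis using that by auto
qed

lemma envelope_nonneg: "0 \<le> envelope t"
  using envelope_attained[of t] e modulus_nonneg by (metis add_nonneg_nonneg mdist_nonneg)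

lemma tau_eq: "\<tau> t = (if t \<in> M' then envelope t else 0)"
  by (simp add: tau_def envelope_def)

lemma tau_nonneg: "0 \<le> \<tau> t"
  by (simp add: tau_eq envelope_nonneg)

lemma omega_lipschitz_dist:
  assumes "k < n"
  shows "omega_lipschitz \<omega> M (\<lambda>t. e k + \<omega> (mdist M t (q k)))"
proof -
  have "omega_lipschitz \<omega> M (\<lambda>t. \<omega> (mdist M t (q k)))"
    using modulus
  proof (rule omega_lipschitz_modulus_comp)
    fix s t assume "s \<in> mspace M" "t \<in> mspace M"
    then show "mdist M s (q k) \<le> mdist M t (q k) + mdist M s t"
      using mdist_triangle[of s M t "q k"] q[OF assms] M'_subset by auto
  qed simp
  then show ?thesis by (simp add: omega_lipschitz_def)
qed

lemma omega_lipschitz_envelope: "omega_lipschitz \<omega> M envelope"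
  unfolding envelope_def using n omega_lipschitz_dist
  by (intro omega_lipschitz_Min) (auto simp: lessThan_empty_iff)

lemma bdry_dist_le: "s \<in> bdry M M' \<Longrightarrow> bdry_dist M M' t \<le> mdist M t s"
  unfolding bdry_dist_def by (intro cINF_lower bdd_belowI2[of _ 0]) auto

lemma bdry_dist_nonneg: "bdry M M' \<noteq> {} \<Longrightarrow> 0 \<le> bdry_dist M M' t"
  unfolding bdry_dist_def by (intro cINF_greatest) auto

lemma bdry_dist_approx:
  assumes "bdry M M' \<noteq> {}" "\<delta> > 0"
  obtains s where "s \<in> bdry M M'" "mdist M t s < bdry_dist M M' t + \<delta>"
proof -
  have "Inf (mdist M t ` bdry M M') < bdry_dist M M' t + \<delta>"
    using assms by (simp add: bdry_dist_def)
  then obtain d where "d \<in> mdist M t ` bdry M M'" "d < bdry_dist M M' t + \<delta>"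
    using assms(1) by (metis cInf_lessD image_is_empty)
  then show thesis using that by auto
qed

lemma omega_lipschitz_bdry_dist:
  assumes "bdry M M' \<noteq> {}"
  shows "omega_lipschitz \<omega> M (\<lambda>t. \<omega> (bdry_dist M M' t))"
  using modulus
proof (rule omega_lipschitz_modulus_comp)
  fix s t assume st: "s \<in> mspace M" "t \<in> mspace M"
  \<comment> \<open>Moving the distance to the left turns the claim into a lower bound for an
    infimum, which can be checked at each boundary point by the triangle inequality.\<close>
  have "bdry_dist M M' s - mdist M s t \<le> bdry_dist M M' t"
    unfolding bdry_dist_def[of M M' t]
  proof (rule cINF_greatest[OF assms])
    fix r assume r: "r \<in> bdry M M'"
    then have "r \<in> mspace M" using bdry_subset M'_subset by auto
    then show "bdry_dist M M' s - mdist M s t \<le> mdist M t r"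
      using bdry_dist_le[OF r, of s] mdist_triangle[of s M t r] st by linarith
  qed
  then show "bdry_dist M M' s \<le> bdry_dist M M' t + mdist M s t" by simp
qed (simp add: bdry_dist_nonneg assms)

lemma bdry_dist_zero:
  assumes "s \<in> bdry M M'"
  shows "bdry_dist M M' s = 0"
proof -
  have "s \<in> mspace M" using assms bdry_subset M'_subset by auto
  then show ?thesis
    using bdry_dist_le[OF assms, of s] bdry_dist_nonneg[of s] mdist_self[of s M] assms
    by (intro antisym) auto
qed

lemma tau_in_H_class: "\<tau> \<in> H_class \<omega> M M'"
proof -
  have "\<tau> \<in> C_class M M'"
    unfolding C_class_def
    using omega_lipschitz_continuous[OF modulus omega_lipschitz_envelope]
    by (auto intro!: exI[of _ envelope] simp: tau_eq)
  moreover have "\<bar>\<tau> s - \<tau> t\<bar> \<le> \<omega> (mdist M s t)" if "s \<in> M'" "t \<in> M'" for s t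
    using that omega_lipschitz_abs[OF omega_lipschitz_envelope, of s t] M'_subset
    by (auto simp: tau_eq)
  ultimately show ?thesis by (auto simp: H_class_def)
qed

text \<open>The analogue of \<open>envelope\<close> for the second class. Being defined beyond
  \<open>M'\<close>, it can be glued with 0 along the boundary.\<close>

definition envelope_tilde :: "'a \<Rightarrow> real" where
  "envelope_tilde t =
     (if bdry M M' = {} then envelope t else min (envelope t) (\<omega> (bdry_dist M M' t)))"

lemma tau_tilde_eq: "\<tau>t t = (if t \<in> M' then envelope_tilde t else 0)"
  using modulus_nonneg[OF bdry_dist_nonneg]
  by (auto simp: tau_tilde_def tau_eq envelope_tilde_def)

lemma tau_tilde_nonneg: "0 \<le> \<tau>t t"
  using modulus_nonneg[OF bdry_dist_nonneg] tau_nonneg by (auto simp: tau_tilde_def)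

lemma tau_tilde_le_tau: "\<tau>t t \<le> \<tau> t"
  by (simp add: tau_tilde_def)

lemma omega_lipschitz_envelope_tilde: "omega_lipschitz \<omega> M envelope_tilde"
proof (cases "bdry M M' = {}")
  case True
  then show ?thesis using omega_lipschitz_envelope by (simp add: envelope_tilde_def[abs_def])
next
  case False
  then show ?thesis
    using omega_lipschitz_min[OF omega_lipschitz_envelope omega_lipschitz_bdry_dist[OF False]]
    by (simp add: envelope_tilde_def[abs_def])
qed

lemma tau_tilde_in_H_tilde_class: "\<tau>t \<in> H_tilde_class \<omega> M M'"
proof -
  have cont: "continuous_map (mtopology_of M) euclideanreal envelope_tilde"
    using omega_lipschitz_continuous[OF modulus omega_lipschitz_envelope_tilde] .
  \<comment> \<open>The two pieces agree on the boundary: there the distance is 0 and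
    \<open>envelope\<close> is non-negative. Hence extension by 0 outside \<open>M'\<close> stays
    continuous.\<close>
  have "envelope_tilde s = 0" if "s \<in> bdry M M'" for s
    using that envelope_nonneg[of s] by (auto simp: envelope_tilde_def bdry_dist_zero modulus_zero)
  then have "continuous_map (mtopology_of M) euclideanreal (\<lambda>t. if t \<in> M' then envelope_tilde t else 0)"
    using cont by (intro continuous_map_cases continuous_map_from_subtopology) auto
  then have "continuous_map (mtopology_of M) euclideanreal \<tau>t"
    by (simp add: tau_tilde_eq[abs_def])
  moreover have "supp M \<tau>t \<subseteq> M'"
    unfolding supp_def using closed by (intro closure_of_minimal) (auto simp: tau_tilde_eq)
  moreover have "\<tau>t \<in> C_class M M'"
    unfolding C_class_def using cont by (auto intro!: exI[of _ envelope_tilde] simp: tau_tilde_eq)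
  moreover have "\<bar>\<tau>t s - \<tau>t t\<bar> \<le> \<omega> (mdist M s t)" if "s \<in> M'" "t \<in> M'" for s t
    using that omega_lipschitz_abs[OF omega_lipschitz_envelope_tilde, of s t] M'_subset
    by (auto simp: tau_tilde_eq)
  ultimately show ?thesis
    by (auto simp: H_tilde_class_def C_tilde_class_def H_class_def)
qed

text \<open>A function of this class vanishes on the boundary, so its value at \<open>t\<close> is
  controlled by the distance to an almost nearest boundary point.\<close>

lemma abs_le_modulus_bdry_dist:
  assumes x: "x \<in> H_tilde_class \<omega> M M'" and t: "t \<in> M'" and ne: "bdry M M' \<noteq> {}"
  shows "\<bar>x t\<bar> \<le> \<omega> (bdry_dist M M' t)"
proof (rule field_le_epsilon)
  fix \<epsilon> :: real assume "\<epsilon> > 0"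
  then obtain \<delta> where \<delta>: "\<delta> > 0" "\<And>d. 0 \<le> d \<Longrightarrow> d < \<delta> \<Longrightarrow> \<omega> d < \<epsilon>"
    using modulus_small[OF modulus] by metis
  \<comment> \<open>The slack is half of \<delta>, strictly below \<delta>, so the excess that
    subadditivity splits off is less than \<epsilon>.\<close>
  then obtain s where s: "s \<in> bdry M M'" "mdist M t s < bdry_dist M M' t + \<delta> / 2"
    using bdry_dist_approx[OF ne, of "\<delta> / 2"] by auto
  have "x s = 0"
  proof (rule continuous_map_zero_on_frontier[OF _ _ s(1)])
    show "continuous_map (mtopology_of M) euclideanreal x"
      using x by (simp add: H_tilde_class_def C_tilde_class_def)
    fix r assume "r \<in> topspace (mtopology_of M)" "r \<notin> M'"
    then show "x r = 0"
      using x by (auto simp: H_tilde_class_def H_class_def C_class_def)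
  qed
  moreover have "\<bar>x t - x s\<bar> \<le> \<omega> (mdist M t s)"
    using x t s bdry_subset by (auto simp: H_tilde_class_def H_class_def)
  moreover have "\<omega> (mdist M t s) \<le> \<omega> (bdry_dist M M' t + \<delta> / 2)"
    using modulus s \<delta> bdry_dist_nonneg[OF ne, of t]
    by (auto simp: modulus_of_continuity_def intro!: mono_onD[of "{0..}" \<omega>])
  moreover have "\<omega> (bdry_dist M M' t + \<delta> / 2) \<le> \<omega> (bdry_dist M M' t) + \<omega> (\<delta> / 2)"
    using modulus \<delta> bdry_dist_nonneg[OF ne, of t] by (auto simp: modulus_of_continuity_def)
  moreover have "\<omega> (\<delta> / 2) < \<epsilon>" using \<delta> by simp
  ultimately show "\<bar>x t\<bar> \<le> \<omega> (bdry_dist M M' t) + \<epsilon>" by simp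
qed

section \<open>The partition of \<open>M'\<close> and the pointwise recovery error\<close>

lemma Pi_part_subset: "Pi_part M M' \<omega> n q e k \<subseteq> Pi_prime M M' \<omega> n q e k"
  by (subst Pi_part.simps) auto

lemma Pi_part_subset_M': "Pi_part M M' \<omega> n q e k \<subseteq> M'"
  using Pi_part_subset[of k] by (auto simp: Pi_prime_def)

lemma Pi_part_notin: "t \<in> Pi_part M M' \<omega> n q e k \<Longrightarrow> s < k \<Longrightarrow> t \<notin> Pi_part M M' \<omega> n q e s"
  by (subst (asm) Pi_part.simps) auto

lemma Pi_part_cover:
  assumes "t \<in> M'"
  obtains k where "k < n" "t \<in> Pi_part M M' \<omega> n q e k"
proof -
  obtain k where k: "k < n" "envelope t = e k + \<omega> (mdist M t (q k))"
    by (rule envelope_attained)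
  then have "t \<in> Pi_prime M M' \<omega> n q e k" using assms by (simp add: Pi_prime_def tau_eq)
  \<comment> \<open>If \<open>t\<close> is not in part \<open>k\<close>, it was removed because an
    earlier part owns it; in either case the owner has index at most \<open>k\<close>, hence below
    \<open>n\<close>.\<close>
  then have "\<exists>s\<le>k. t \<in> Pi_part M M' \<omega> n q e s"
    using Pi_part.simps[of M M' \<omega> n q e k] by (metis DiffI UN_E lessThan_iff less_imp_le order_refl)
  then show thesis using k(1) that by (meson le_less_trans)
qed

lemma L_op_eq:
  assumes "k < n" "t \<in> Pi_part M M' \<omega> n q e k"
  shows "L_op M M' \<omega> n q e z t = z k"
proof -
  have "L_op M M' \<omega> n q e z t = (\<Sum>s<n. if s = k then z s else 0)"
    unfolding L_op_def
  proof (rule sum.cong)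
    fix s
    have "t \<in> Pi_part M M' \<omega> n q e s \<longleftrightarrow> s = k"
      using assms(2) Pi_part_notin by (metis linorder_neqE_nat)
    then show "z s * indicator (Pi_part M M' \<omega> n q e s) t = (if s = k then z s else 0)"
      by (auto simp: indicator_def)
  qed simp
  then show ?thesis using assms by simp
qed

lemma L_op_outside: "t \<notin> M' \<Longrightarrow> L_op M M' \<omega> n q e z t = 0"
  unfolding L_op_def using Pi_part_subset
  by (intro sum.neutral) (auto simp: Pi_prime_def indicator_def)

lemma L_tilde_op_eq:
  "L_tilde_op M M' \<omega> n q e z t =
     (if t \<in> Pi_tilde_zero M M' \<omega> n q e then 0 else L_op M M' \<omega> n q e z t)"
  by (simp add: L_tilde_op_def L_op_def Pi_tilde_def indicator_def)

text \<open>On part \<open>k\<close> the method returns \<open>x (q k) + u k\<close>. The two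
  sources of error, distance and noise, add up to exactly the expression that equals \<tau> on that
  part.\<close>

lemma L_op_error:
  assumes x: "x \<in> H_class \<omega> M M'" and u: "u \<in> U_box n e" and t: "t \<in> mspace M"
  shows "\<bar>x t - L_op M M' \<omega> n q e (\<lambda>k. info n q x k + u k) t\<bar> \<le> \<tau> t"
proof (cases "t \<in> M'")
  case True
  obtain k where k: "k < n" "t \<in> Pi_part M M' \<omega> n q e k"
    by (rule Pi_part_cover[OF True])
  have "\<bar>x t - x (q k)\<bar> \<le> \<omega> (mdist M t (q k))"
    using x True q[OF k(1)] by (auto simp: H_class_def)
  moreover have "\<bar>u k\<bar> \<le> e k" using u k by (auto simp: U_box_def abs_le_iff)
  moreover have "\<tau> t = e k + \<omega> (mdist M t (q k))"
    using k Pi_part_subset by (auto simp: Pi_prime_def)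
  ultimately show ?thesis by (simp add: L_op_eq[OF k] info_def k)
next
  case False
  then have "x t = 0" using x t by (auto simp: H_class_def C_class_def)
  then show ?thesis using False by (simp add: L_op_outside tau_nonneg)
qed

lemma L_tilde_op_error:
  assumes x: "x \<in> H_tilde_class \<omega> M M'" and u: "u \<in> U_box n e" and t: "t \<in> mspace M"
  shows "\<bar>x t - L_tilde_op M M' \<omega> n q e (\<lambda>k. info n q x k + u k) t\<bar> \<le> \<tau>t t"
proof (cases "t \<in> Pi_tilde_zero M M' \<omega> n q e")
  case True
  then have "\<bar>x t\<bar> \<le> \<omega> (bdry_dist M M' t)" "\<tau>t t = \<omega> (bdry_dist M M' t)"
    using abs_le_modulus_bdry_dist[OF x] by (auto simp: Pi_tilde_zero_def tau_tilde_def)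
  then show ?thesis using True by (simp add: L_tilde_op_eq)
next
  case False
  \<comment> \<open>Off \<open>Pi_tilde_zero\<close> the boundary term is absent or larger than
    \<tau>, and outside \<open>M'\<close> both functions are 0, so the estimate for
    \<open>L_op\<close> applies.\<close>
  have "\<tau>t t = \<tau> t"
  proof (cases "t \<in> M'")
    case True
    then show ?thesis using False by (auto simp: Pi_tilde_zero_def tau_tilde_def)
  next
    case False
    then show ?thesis by (simp add: tau_tilde_eq tau_eq)
  qed
  then show ?thesis
    using False x L_op_error[OF _ u t, of x] by (simp add: L_tilde_op_eq H_tilde_class_def)
qed

section \<open>Measurability and boundedness of the recovered functions\<close>

context
  fixes \<mu> :: "'a measure"
  assumes \<mu>: "is_borel_measure M \<mu>"
begin

lemma Pi_part_sets: "Pi_part M M' \<omega> n q e k \<in> sets \<mu>" if "k < n" for k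
  using that
proof (induction k rule: less_induct)
  case (less k)
  have [measurable]: "envelope \<in> borel_measurable \<mu>"
    "(\<lambda>t. e k + \<omega> (mdist M t (q k))) \<in> borel_measurable \<mu>"
    using omega_lipschitz_continuous[OF modulus] omega_lipschitz_envelope
      omega_lipschitz_dist[OF less.prems]
    by (auto intro: continuous_map_borel_measurable[OF \<mu>])
  \<comment> \<open>Inside the closed set \<open>M'\<close> this is the set where two continuous
    functions agree.\<close>
  have "Pi_prime M M' \<omega> n q e k =
      M' \<inter> {t \<in> space \<mu>. envelope t = e k + \<omega> (mdist M t (q k))}"
    using M'_subset space_borel_measure[OF \<mu>] by (auto simp: Pi_prime_def tau_eq)
  also have "\<dots> \<in> sets \<mu>"
    using closedin_sets_borel_measure[OF \<mu> closed] by measurable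
  finally show ?case
    using less by (subst Pi_part.simps) auto
qed

lemma Pi_tilde_zero_sets: "Pi_tilde_zero M M' \<omega> n q e \<in> sets \<mu>"
proof (cases "bdry M M' = {}")
  case True
  then show ?thesis by (simp add: Pi_tilde_zero_def)
next
  case False
  have [measurable]: "envelope \<in> borel_measurable \<mu>"
    "(\<lambda>t. \<omega> (bdry_dist M M' t)) \<in> borel_measurable \<mu>"
    using omega_lipschitz_continuous[OF modulus] omega_lipschitz_envelope
      omega_lipschitz_bdry_dist[OF False]
    by (auto intro: continuous_map_borel_measurable[OF \<mu>])
  have "Pi_tilde_zero M M' \<omega> n q e =
      M' \<inter> {t \<in> space \<mu>. \<omega> (bdry_dist M M' t) \<le> envelope t}"
    using M'_subset space_borel_measure[OF \<mu>] False by (auto simp: Pi_tilde_zero_def tau_eq)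
  also have "\<dots> \<in> sets \<mu>"
    using closedin_sets_borel_measure[OF \<mu> closed] by measurable
  finally show ?thesis .
qed

lemma step_function_in_B_class:
  assumes "\<And>k. k < n \<Longrightarrow> S k \<in> sets \<mu>" "\<And>k. k < n \<Longrightarrow> S k \<subseteq> M'"
  shows "(\<lambda>t. \<Sum>k<n. z k * indicator (S k) t) \<in> B_class M \<mu> M'"
proof (rule B_classI[OF \<mu> closed])
  show "(\<lambda>t. \<Sum>k<n. z k * indicator (S k) t) \<in> borel_measurable \<mu>"
    using assms(1) by (intro borel_measurable_sum borel_measurable_times borel_measurable_indicator) auto
  show "\<bar>\<Sum>k<n. z k * indicator (S k) t\<bar> \<le> (\<Sum>k<n. \<bar>z k\<bar>)" for t
    by (rule order_trans[OF sum_abs sum_mono]) (auto simp: indicator_def)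
  show "(\<Sum>k<n. z k * indicator (S k) t) = 0" if "t \<notin> M'" for t
    using assms(2) that by (intro sum.neutral) (auto simp: indicator_def)
qed

lemma L_op_in_B_class: "L_op M M' \<omega> n q e z \<in> B_class M \<mu> M'"
  unfolding L_op_def[abs_def] by (intro step_function_in_B_class Pi_part_sets Pi_part_subset_M')

lemma L_tilde_op_in_B_class: "L_tilde_op M M' \<omega> n q e z \<in> B_class M \<mu> M'"
  unfolding L_tilde_op_def[abs_def] Pi_tilde_def
  by (intro step_function_in_B_class sets.Diff Pi_part_sets Pi_tilde_zero_sets
      Diff_subset[THEN order_trans] Pi_part_subset_M')

lemma H_class_subset_B_class: "H_class \<omega> M M' \<subseteq> B_class M \<mu> M'"
  using C_class_subset_B_class[OF \<mu> compact closed] by (auto simp: H_class_def)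

end

text \<open>Bundles the two alternatives for the class, so that the optimality proof needs no case
  distinction for each component.\<close>

definition admissible ::
  "('a \<Rightarrow> real) set \<Rightarrow> ('a \<Rightarrow> real) \<Rightarrow> ((nat \<Rightarrow> real) \<Rightarrow> 'a \<Rightarrow> real) \<Rightarrow> bool" where
  "admissible W \<phi> L \<longleftrightarrow>
     (W = H_class \<omega> M M' \<and> \<phi> = \<tau> \<and> L = L_op M M' \<omega> n q e) \<or>
     (W = H_tilde_class \<omega> M M' \<and> \<phi> = \<tau>t \<and> L = L_tilde_op M M' \<omega> n q e)"

context
  fixes W \<phi> L
  assumes adm: "admissible W \<phi> L"
begin

lemma admissible_in_class: "c \<in> {-1, 1} \<Longrightarrow> (\<lambda>t. c * \<phi> t) \<in> W"
  using adm H_class_sign[OF tau_in_H_class] H_tilde_class_sign[OF tau_tilde_in_H_tilde_class]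
  by (auto simp: admissible_def)

text \<open>At a sample point the distance term is \<omega>(0) = 0, which leaves only the noise
  level. This is what makes \<phi> compatible with zero data.\<close>

lemma admissible_bounds: "0 \<le> \<phi> t" "k < n \<Longrightarrow> \<phi> (q k) \<le> e k"
proof -
  show "0 \<le> \<phi> t" using adm tau_nonneg tau_tilde_nonneg by (auto simp: admissible_def)
  assume k: "k < n"
  have "q k \<in> mspace M" using q[OF k] M'_subset by auto
  then have "\<tau> (q k) \<le> e k"
    using envelope_le[OF k, of "q k"] q[OF k] mdist_self[of "q k" M]
    by (simp add: tau_eq modulus_zero)
  then show "\<phi> (q k) \<le> e k"
    using adm tau_tilde_le_tau[of "q k"] by (auto simp: admissible_def)
qed

text \<open>The noise that cancels the true data of \<open>c * \<phi>\<close> is within the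
  permitted bounds, so the observation may be 0.\<close>

lemma admissible_zero_info:
  assumes "c \<in> {-1, 1}"
  shows "(\<lambda>k. - info n q (\<lambda>t. c * \<phi> t) k) \<in> U_box n e"
proof -
  have "- e k \<le> - (c * \<phi> (q k)) \<and> - (c * \<phi> (q k)) \<le> e k" if "k < n" for k
    using admissible_bounds(1)[of "q k"] admissible_bounds(2)[OF that] assms by auto
  then show ?thesis by (auto simp: U_box_def Rvec_def info_def)
qed

lemma admissible_error:
  assumes "x \<in> W" "u \<in> U_box n e" "t \<in> mspace M"
  shows "\<bar>x t - L (\<lambda>k. info n q x k + u k) t\<bar> \<le> \<phi> t"
  using adm assms L_op_error[of x u t] L_tilde_op_error[of x u t] by (auto simp: admissible_def)

lemma admissible_B_class:
  assumes "is_borel_measure M \<mu>"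
  shows "W \<subseteq> B_class M \<mu> M'" "L z \<in> B_class M \<mu> M'" "\<phi> \<in> B_class M \<mu> M'"
proof -
  show W: "W \<subseteq> B_class M \<mu> M'"
    using adm H_class_subset_B_class[OF assms] by (auto simp: admissible_def H_tilde_class_def)
  show "L z \<in> B_class M \<mu> M'"
    using adm L_op_in_B_class[OF assms] L_tilde_op_in_B_class[OF assms] by (auto simp: admissible_def)
  show "\<phi> \<in> B_class M \<mu> M'" using admissible_in_class[of 1] W by auto
qed

end

end

subsection \<open>Positive integral operators and normed lattices\<close>

text \<open>\<open>E\<close> is an arbitrary set here, so the difference is formed under the
  integral and not as \<open>T\<close> applied to \<open>x - y\<close>.\<close>

lemma integral_operator_estimate:
  assumes T: "integral_operator \<mu> N E K T" and K: "nonneg_kernel \<mu> N K"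
    and sf: "sigma_finite_measure \<mu>" "sigma_finite_measure N"
    and E: "x \<in> E" "y \<in> E" "\<phi> \<in> E" and le: "AE t in \<mu>. \<bar>x t - y t\<bar> \<le> \<phi> t"
  shows "AE s in N. \<bar>T x s - T y s\<bar> \<le> T \<phi> s"
proof -
  interpret pair_sigma_finite N \<mu>
    using sf by (simp add: pair_sigma_finite_def)
  \<comment> \<open>The kernel is non-negative almost everywhere on the product; sigma-finiteness
    gives this on almost every section.\<close>
  have K': "AE s in N. AE t in \<mu>. 0 \<le> K s t"
    using AE_pair[OF K[unfolded nonneg_kernel_def]] by simp
  have op: "AE s in N. integrable (completion \<mu>) (\<lambda>t. K s t * f t) \<and>
      T f s = (\<integral>t. K s t * f t \<partial>completion \<mu>)" if "f \<in> E" for f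
    using T that by (auto simp: integral_operator_def)
  show ?thesis
    using K' op[OF E(1)] op[OF E(2)] op[OF E(3)]
  proof eventually_elim
    case (elim s)
    have int: "integrable (completion \<mu>) (\<lambda>t. K s t * x t - K s t * y t)"
      using elim by (intro Bochner_Integration.integrable_diff) auto
    have "\<bar>T x s - T y s\<bar> = \<bar>\<integral>t. K s t * x t - K s t * y t \<partial>completion \<mu>\<bar>"
      using elim by simp
    also have "\<dots> \<le> (\<integral>t. \<bar>K s t * x t - K s t * y t\<bar> \<partial>completion \<mu>)"
      by (rule integral_abs_bound)
    also have "\<dots> \<le> (\<integral>t. K s t * \<phi> t \<partial>completion \<mu>)"
    proof (rule integral_mono_AE)
      show "integrable (completion \<mu>) (\<lambda>t. \<bar>K s t * x t - K s t * y t\<bar>)"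
        using int by (rule integrable_abs)
      show "integrable (completion \<mu>) (\<lambda>t. K s t * \<phi> t)" using elim by simp
      have "AE t in \<mu>. \<bar>K s t * x t - K s t * y t\<bar> \<le> K s t * \<phi> t"
        using elim(1) le
        by eventually_elim (simp add: right_diff_distrib[symmetric] abs_mult mult_left_mono)
      then show "AE t in completion \<mu>. \<bar>K s t * x t - K s t * y t\<bar> \<le> K s t * \<phi> t"
        by (rule AE_completion)
    qed
    also have "\<dots> = T \<phi> s" using elim by simp
    finally show ?case .
  qed
qed

section \<open>Norm estimates in a normed lattice\<close>

context
  fixes N :: "'b measure" and Y :: "('b \<Rightarrow> real) set" and nrm :: "('b \<Rightarrow> real) \<Rightarrow> real"
  assumes nl: "normed_lattice N Y nrm"
begin

lemma normed_lattice_add: "x \<in> Y \<Longrightarrow> y \<in> Y \<Longrightarrow> (\<lambda>s. x s + y s) \<in> Y"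
  and normed_lattice_scale: "x \<in> Y \<Longrightarrow> (\<lambda>s. c * x s) \<in> Y"
  and normed_lattice_zero: "(\<lambda>s. 0) \<in> Y"
  and normed_lattice_nonneg: "x \<in> Y \<Longrightarrow> 0 \<le> nrm x"
  and normed_lattice_norm_scale: "x \<in> Y \<Longrightarrow> nrm (\<lambda>s. c * x s) = \<bar>c\<bar> * nrm x"
  and normed_lattice_triangle: "x \<in> Y \<Longrightarrow> y \<in> Y \<Longrightarrow> nrm (\<lambda>s. x s + y s) \<le> nrm x + nrm y"
  using nl by (simp_all add: normed_lattice_def)

lemma normed_lattice_norm_cong: "x \<in> Y \<Longrightarrow> y \<in> Y \<Longrightarrow> ae_eq N x y \<Longrightarrow> nrm x = nrm y"
  using nl unfolding normed_lattice_def by blast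

lemma normed_lattice_diff:
  assumes "x \<in> Y" "y \<in> Y"
  shows "(\<lambda>s. x s - y s) \<in> Y"
  using normed_lattice_add[OF assms(1) normed_lattice_scale[OF assms(2), of "-1"]] by simp

lemma normed_lattice_sum:
  assumes "finite I" "\<And>j. j \<in> I \<Longrightarrow> x j \<in> Y"
  shows "(\<lambda>s. \<Sum>j\<in>I. x j s) \<in> Y"
  using assms by (induction I rule: finite_induct) (auto simp: normed_lattice_zero normed_lattice_add)

text \<open>The lattice axiom compares moduli formed in \<open>Y\<close>, which need not be
  pointwise. The modulus of \<open>f\<close> is a least upper bound and \<open>g\<close> is an upper
  bound of \<open>f\<close> and \<open>-f\<close>, so it lies below \<open>g\<close>; and
  \<open>g\<close>, being non-negative a.e., is its own modulus.\<close>

lemma normed_lattice_mono: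
  assumes f: "f \<in> Y" and g: "g \<in> Y" and le: "AE s in N. \<bar>f s\<bar> \<le> g s"
  shows "nrm f \<le> nrm g"
proof -
  have "(\<lambda>s. - f s) \<in> Y" using normed_lattice_scale[OF f, of "-1"] by simp
  then obtain u where u: "is_abs_in N Y f u"
    using nl f unfolding normed_lattice_def is_abs_in_def by blast
  have "ae_le N f g" "ae_le N (\<lambda>s. - f s) g"
    unfolding ae_le_def using le by (eventually_elim, simp)+
  then have ug: "ae_le N u g" using u g by (auto simp: is_abs_in_def is_sup_in_def)
  have "ae_le N (\<lambda>s. - g s) g"
    unfolding ae_le_def using le by eventually_elim simp
  then have "is_abs_in N Y g g"
    using g by (auto simp: is_abs_in_def is_sup_in_def ae_le_def)
  then show ?thesis using nl f g u ug unfolding normed_lattice_def by blast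
qed

text \<open>Almost everywhere \<open>2g = (p - h) - (m - h)\<close>, so one answer \<open>h\<close>
  cannot be close to both of two opposite images. The images are given only up to null sets, as are
  the values of an integral operator.\<close>

lemma normed_lattice_symmetric_pair:
  assumes Y: "p \<in> Y" "m \<in> Y" "g \<in> Y" "h \<in> Y"
    and p: "ae_eq N p g" and m: "ae_eq N m (\<lambda>s. - g s)"
  shows "2 * nrm g \<le> nrm (\<lambda>s. p s - h s) + nrm (\<lambda>s. m s - h s)"
proof -
  let ?a = "\<lambda>s. p s - h s" and ?b = "\<lambda>s. m s - h s"
  have a: "?a \<in> Y" and b: "?b \<in> Y" using Y by (auto intro: normed_lattice_diff)
  have mb: "(\<lambda>s. -1 * ?b s) \<in> Y" using b by (rule normed_lattice_scale)
  have "ae_eq N (\<lambda>s. 2 * g s) (\<lambda>s. ?a s + -1 * ?b s)"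
    using p m unfolding ae_eq_def by eventually_elim simp
  then have "nrm (\<lambda>s. 2 * g s) = nrm (\<lambda>s. ?a s + -1 * ?b s)"
    by (intro normed_lattice_norm_cong normed_lattice_scale normed_lattice_add Y a mb)
  also have "\<dots> \<le> nrm ?a + nrm (\<lambda>s. -1 * ?b s)"
    using a mb by (rule normed_lattice_triangle)
  also have "nrm (\<lambda>s. -1 * ?b s) = nrm ?b"
    using normed_lattice_norm_scale[OF b, of "-1"] by simp
  finally show ?thesis using normed_lattice_norm_scale[OF Y(3), of 2] by simp
qed

end

subsection \<open>Optimality\<close>

theorem theorem3p2:
  fixes \<psi> :: "real ^ 'l \<Rightarrow> real"
    and n :: "'m::finite \<Rightarrow> nat"
    and \<omega> :: "'m \<Rightarrow> real \<Rightarrow> real"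
    and e :: "'m \<Rightarrow> nat \<Rightarrow> real"
    and M :: "'m \<Rightarrow> 'a metric"
    and \<mu> :: "'m \<Rightarrow> 'a measure"
    and M' :: "'m \<Rightarrow> 'a set"
    and q :: "'m \<Rightarrow> nat \<Rightarrow> 'a"
    and N :: "'l \<Rightarrow> 'b measure"
    and A :: "'l \<Rightarrow> 'm \<Rightarrow> ('a \<Rightarrow> real) \<Rightarrow> 'b \<Rightarrow> real"
    and K :: "'l \<Rightarrow> 'm \<Rightarrow> 'b \<Rightarrow> 'a \<Rightarrow> real"
    and Y :: "'l \<Rightarrow> ('b \<Rightarrow> real) set"
    and nrm :: "'l \<Rightarrow> ('b \<Rightarrow> real) \<Rightarrow> real"
    and W :: "'m \<Rightarrow> ('a \<Rightarrow> real) set"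
    and \<phi> :: "'m \<Rightarrow> 'a \<Rightarrow> real"
    and L :: "'m \<Rightarrow> (nat \<Rightarrow> real) \<Rightarrow> 'a \<Rightarrow> real"
    and \<sigma> :: "'m \<Rightarrow> real"
  assumes "monotone_norm \<psi>"
    and "\<And>j. n j \<ge> 1"
    and "\<And>j. modulus_of_continuity (\<omega> j)"
    and "\<And>j k. k < n j \<Longrightarrow> 0 \<le> e j k"
    and "\<And>j. is_borel_measure (M j) (\<mu> j)"
    and "\<And>j. sigma_finite_measure (\<mu> j)"
    and "\<And>j. compactin (mtopology_of (M j)) (M' j)"
    and "\<And>j k. k < n j \<Longrightarrow> q j k \<in> M' j"
    and "\<And>i. sigma_finite_measure (N i)"
    and "\<And>i j. integral_operator (\<mu> j) (N i) (B_class (M j) (\<mu> j) (M' j)) (K i j) (A i j)"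
    and "\<And>i j. nonneg_kernel (\<mu> j) (N i) (K i j)"
    and "\<And>i. normed_lattice (N i) (Y i) (nrm i)"
    and "\<And>i. (\<Union>j. A i j ` B_class (M j) (\<mu> j) (M' j)) \<subseteq> Y i"
    and "\<And>j. (W j = H_class (\<omega> j) (M j) (M' j) \<and>
               \<phi> j = tau (M j) (M' j) (\<omega> j) (n j) (q j) (e j) \<and>
               L j = L_op (M j) (M' j) (\<omega> j) (n j) (q j) (e j)) \<or>
              (W j = H_tilde_class (\<omega> j) (M j) (M' j) \<and>
               \<phi> j = tau_tilde (M j) (M' j) (\<omega> j) (n j) (q j) (e j) \<and>
               L j = L_tilde_op (M j) (M' j) (\<omega> j) (n j) (q j) (e j))"
    and "\<And>j. \<sigma> j \<in> {-1, 1}"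
  defines "T \<equiv> mat_sigma_op A \<sigma>"
    and "\<Phi> \<equiv> \<lambda>z. mat_sigma_op A \<sigma> (diag_op L z)"
    and "WW \<equiv> {x. \<forall>j. x j \<in> W j}"
    and "II \<equiv> diag_op (\<lambda>j. info (n j) (q j))"
    and "UU \<equiv> {u. \<forall>j. u j \<in> U_box (n j) (e j)}"
    and "ZZ \<equiv> {z. \<forall>j. z j \<in> Rvec (n j)}"
    and "YY \<equiv> {y. \<forall>i. y i \<in> Y i}"
  shows "optimal_method \<psi> nrm ZZ YY T WW II UU \<Phi> \<and>
         optimal_error \<psi> nrm ZZ YY T WW II UU = method_error \<psi> nrm T WW II UU \<Phi> \<and>
         method_error \<psi> nrm T WW II UU \<Phi> = ereal (norm_psi \<psi> nrm (mat_op A \<phi>))"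
proof -
  have samp: "sampling (M j) (M' j) (\<omega> j) (n j) (q j) (e j)" for j
    using assms(2,3,4,7,8) by unfold_locales auto
  have adm: "sampling.admissible (M j) (M' j) (\<omega> j) (n j) (q j) (e j) (W j) (\<phi> j) (L j)" for j
    using assms(14)[of j] by (simp add: sampling.admissible_def[OF samp])
  define B where "B j = B_class (M j) (\<mu> j) (M' j)" for j
  have WB: "x \<in> W j \<Longrightarrow> x \<in> B j" and LB: "L j z \<in> B j" and \<phi>B: "\<phi> j \<in> B j" for j x z
    using sampling.admissible_B_class[OF samp adm assms(5), of j] by (auto simp: B_def)
  have AY: "A i j x \<in> Y i" if "x \<in> B j" for i j x
    using assms(13)[of i] that by (auto simp: B_def)
  have TY: "mat_sigma_op A \<sigma> x i \<in> Y i" if "\<And>j. x j \<in> B j" for x i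
    unfolding mat_sigma_op_def using that
    by (intro normed_lattice_sum[OF assms(12)] normed_lattice_scale[OF assms(12)] AY) auto
  have GY: "mat_op A \<phi> i \<in> Y i" for i
    unfolding mat_op_def by (intro normed_lattice_sum[OF assms(12)] AY \<phi>B) auto
  have \<psi>_mono: "\<psi> a \<le> \<psi> b" if "\<And>i. 0 \<le> a $ i" "\<And>i. a $ i \<le> b $ i" for a b
    using assms(1) that by (auto simp: monotone_norm_def)

  have upper: "norm_psi \<psi> nrm (\<lambda>i s. T x i s - \<Phi> z i s) \<le> norm_psi \<psi> nrm (mat_op A \<phi>)"
    if x: "x \<in> WW" and z: "z \<in> noisy_info II UU x" for x z
  proof -
    obtain u where u: "\<And>j. u j \<in> U_box (n j) (e j)"
      and z_eq: "\<And>j. z j = (\<lambda>k. info (n j) (q j) (x j) k + u j k)"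
      using z by (auto simp: noisy_info_def II_def UU_def diag_op_def)
    have xW: "x j \<in> W j" for j using x by (simp add: WW_def)
    have est: "AE s in N i. \<bar>A i j (x j) s - A i j (L j (z j)) s\<bar> \<le> A i j (\<phi> j) s" for i j
    proof (rule integral_operator_estimate[OF assms(10,11,6,9)])
      show "AE t in \<mu> j. \<bar>x j t - L j (z j) t\<bar> \<le> \<phi> j t"
        using sampling.admissible_error[OF samp adm xW u]
        by (intro AE_I2) (simp add: z_eq space_borel_measure[OF assms(5)])
    qed (use WB[OF xW] LB \<phi>B in \<open>auto simp: B_def\<close>)
    have Txi: "T x i \<in> Y i" and \<Phi>zi: "\<Phi> z i \<in> Y i" for i
      unfolding T_def \<Phi>_def diag_op_def using WB[OF xW] LB by (auto intro: TY)
    have le: "nrm i (\<lambda>s. T x i s - \<Phi> z i s) \<le> nrm i (mat_op A \<phi> i)" for i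
    proof (rule normed_lattice_mono[OF assms(12) normed_lattice_diff[OF assms(12) Txi \<Phi>zi] GY])
      \<comment> \<open>Finitely many exceptional null sets are united, so that the sum over
        \<open>j\<close> can be estimated at one point.\<close>
      have "AE s in N i. \<forall>j\<in>UNIV. \<bar>A i j (x j) s - A i j (L j (z j)) s\<bar> \<le> A i j (\<phi> j) s"
        using est by (intro AE_finite_allI) auto
      then show "AE s in N i. \<bar>T x i s - \<Phi> z i s\<bar> \<le> mat_op A \<phi> i s"
      proof eventually_elim
        case (elim s)
        have "T x i s - \<Phi> z i s = (\<Sum>j\<in>UNIV. \<sigma> j * (A i j (x j) s - A i j (L j (z j)) s))"
          by (simp add: T_def \<Phi>_def mat_sigma_op_def diag_op_def sum_subtractf right_diff_distrib)
        also have "\<bar>\<dots>\<bar> \<le> (\<Sum>j\<in>UNIV. \<bar>\<sigma> j * (A i j (x j) s - A i j (L j (z j)) s)\<bar>)"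
          by (rule sum_abs)
        also have "\<dots> \<le> (\<Sum>j\<in>UNIV. A i j (\<phi> j) s)"
        proof (rule sum_mono)
          fix j
          have "\<bar>\<sigma> j\<bar> = 1" using assms(15)[of j] by auto
          then show "\<bar>\<sigma> j * (A i j (x j) s - A i j (L j (z j)) s)\<bar> \<le> A i j (\<phi> j) s"
            using elim by (simp add: abs_mult)
        qed
        finally show ?case by (simp add: mat_op_def)
      qed
    qed
    show ?thesis
      unfolding norm_psi_def
      \<comment> \<open>Monotonicity of \<psi> is available only between non-negative vectors, hence
        the appeal to non-negativity of the norms.\<close>
      using le normed_lattice_nonneg[OF assms(12) normed_lattice_diff[OF assms(12) Txi \<Phi>zi]]
      by (intro \<psi>_mono) auto
  qed

  \<comment> \<open>The inputs \<open>\<plusminus>\<sigma>\<phi>\<close> are indistinguishable: both admit the noisy information \<open>0\<close>, while their images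
    under \<open>T\<close> are a.e. equal to \<open>\<plusminus>A\<phi>\<close>.\<close>
  have lower: "ereal (norm_psi \<psi> nrm (mat_op A \<phi>)) \<le> method_error \<psi> nrm T WW II UU \<Psi>"
    if \<Psi>: "\<Psi> \<in> ZZ \<rightarrow> YY" for \<Psi>
  proof -
    define x where "x c j t = c * \<sigma> j * \<phi> j t" for c :: real and j t
    define E where "E c = norm_psi \<psi> nrm (\<lambda>i s. T (x c) i s - \<Psi> (\<lambda>j k. 0) i s)" for c
    have sgn: "c * \<sigma> j \<in> {-1, 1}" if "c \<in> {-1, 1}" for c j
      using that assms(15)[of j] by auto
    have xW: "x c j \<in> W j" if "c \<in> {-1, 1}" for c j
      unfolding x_def using sampling.admissible_in_class[OF samp adm sgn[OF that]] .
    have E_le: "ereal (E c) \<le> method_error \<psi> nrm T WW II UU \<Psi>" if c: "c \<in> {-1, 1}" for c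
    proof -
      \<comment> \<open>The noise is chosen as the negative of the true data, so the observation
        becomes 0 for either sign.\<close>
      have "(\<lambda>j k. - info (n j) (q j) (x c j) k) \<in> UU"
        unfolding UU_def x_def using sampling.admissible_zero_info[OF samp adm sgn[OF c]] by simp
      then have "(\<lambda>j k. 0) \<in> noisy_info II UU (x c)"
        unfolding noisy_info_def II_def diag_op_def
        by (auto intro!: exI[of _ "\<lambda>j k. - info (n j) (q j) (x c j) k"])
      moreover have "x c \<in> WW" using xW[OF c] by (simp add: WW_def)
      ultimately show ?thesis
        unfolding method_error_def E_def
        by (intro SUP_upper2[of "x c"] SUP_upper2[of "\<lambda>j k. 0"]) auto
    qed
    have Tx: "T (x c) i \<in> Y i" if "c \<in> {-1, 1}" for c i
      unfolding T_def using WB[OF xW[OF that]] by (intro TY)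
    have Tx_eq: "ae_eq (N i) (T (x c) i) (\<lambda>s. c * mat_op A \<phi> i s)" for c i
    proof -
      have "ae_eq (N i) (A i j (x c j)) (\<lambda>s. c * \<sigma> j * A i j (\<phi> j) s)" for j
        using assms(10)[of j i] \<phi>B[of j] unfolding integral_operator_def B_def x_def by blast
      then have "AE s in N i. \<forall>j\<in>UNIV. A i j (x c j) s = c * \<sigma> j * A i j (\<phi> j) s"
        unfolding ae_eq_def by (intro AE_finite_allI) auto
      then show ?thesis
        unfolding ae_eq_def
      proof eventually_elim
        case (elim s)
        \<comment> \<open>The square of \<open>\<sigma> j\<close> is 1: the sign built into the
          input cancels the one in \<open>T\<close>.\<close>
        have "\<sigma> j * A i j (x c j) s = c * A i j (\<phi> j) s" for j
          using assms(15)[of j] elim by auto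
        then show ?case
          by (simp add: T_def mat_sigma_op_def mat_op_def sum_distrib_left)
      qed
    qed
    have \<Psi>Y: "\<Psi> (\<lambda>j k. 0) i \<in> Y i" for i
      using \<Psi> by (auto simp: ZZ_def YY_def Rvec_def Pi_iff)
    define v where "v c = (\<chi> i. nrm i (\<lambda>s. T (x c) i s - \<Psi> (\<lambda>j k. 0) i s))" for c
    define w where "w = (\<chi> i. nrm i (mat_op A \<phi> i))"
    have pair: "2 * nrm i (mat_op A \<phi> i) \<le> v 1 $ i + v (-1) $ i" for i
      using normed_lattice_symmetric_pair[OF assms(12) Tx[of 1] Tx[of "-1"] GY \<Psi>Y, of i]
        Tx_eq[of i 1] Tx_eq[of i "-1"] by (simp add: v_def)
    \<comment> \<open>The componentwise bound passes through \<psi>, so the mean of the two errors,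
      and hence the larger one, is at least \<open>\<psi> w\<close>.\<close>
    have "2 * \<psi> w = \<psi> (2 *\<^sub>R w)"
      using assms(1) by (simp add: monotone_norm_def is_norm_def)
    also have "\<dots> \<le> \<psi> (v 1 + v (-1))"
      using pair normed_lattice_nonneg[OF assms(12) GY] by (intro \<psi>_mono) (auto simp: w_def)
    also have "\<dots> \<le> \<psi> (v 1) + \<psi> (v (-1))"
      using assms(1) by (simp add: monotone_norm_def is_norm_def)
    finally have "norm_psi \<psi> nrm (mat_op A \<phi>) \<le> max (E 1) (E (-1))"
      by (simp add: norm_psi_def E_def v_def w_def)
    then have "ereal (norm_psi \<psi> nrm (mat_op A \<phi>)) \<le> max (ereal (E 1)) (ereal (E (-1)))"
      by (simp add: max_def split: if_splits)
    also have "\<dots> \<le> method_error \<psi> nrm T WW II UU \<Psi>" using E_le by simp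
    finally show ?thesis .
  qed

  have \<Phi>: "\<Phi> \<in> ZZ \<rightarrow> YY"
    unfolding \<Phi>_def YY_def diag_op_def using LB by (auto intro: TY)
  have err: "method_error \<psi> nrm T WW II UU \<Phi> = ereal (norm_psi \<psi> nrm (mat_op A \<phi>))"
  proof (rule antisym)
    show "method_error \<psi> nrm T WW II UU \<Phi> \<le> ereal (norm_psi \<psi> nrm (mat_op A \<phi>))"
      unfolding method_error_def using upper by (intro SUP_least) simp
  qed (rule lower[OF \<Phi>])
  have "optimal_error \<psi> nrm ZZ YY T WW II UU = method_error \<psi> nrm T WW II UU \<Phi>"
    unfolding optimal_error_def
  proof (rule antisym)
    show "(INF \<Psi>\<in>ZZ \<rightarrow> YY. method_error \<psi> nrm T WW II UU \<Psi>) \<le> method_error \<psi> nrm T WW II UU \<Phi>"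
      by (rule INF_lower[OF \<Phi>])
    show "method_error \<psi> nrm T WW II UU \<Phi> \<le> (INF \<Psi>\<in>ZZ \<rightarrow> YY. method_error \<psi> nrm T WW II UU \<Psi>)"
      \<comment> \<open>The lower bound holds for every method, hence for the infimum, and \<Phi>
        attains it.\<close>
      unfolding err using lower by (rule INF_greatest)
  qed
  then show ?thesis using err \<Phi> by (simp add: optimal_method_def)
qed

end
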